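(* Let $f\colon X\to\mathbb{R}$ be a filter on a Lefschetz complex, $S\subseteq\mathrm{BD}(f)$ a shallow cancelable subset of the birth-death pairs, and $\chi\in\mathrm{BD}(f)\setminus S$. Then canceling $S$ renders $\chi$ shallow, i.e. $\chi\in\mathrm{SH}(f^S)$, if and only if $$\{\xi\in\mathrm{BD}(f)\mid \xi<_f\chi\}\subseteq S,$$ where $<_f$ is the strict order relation of the depth poset $\mathcal{D}_f$.
   Context: Fix a field $\mathbb{F}$. A Lefschetz complex is a triple $(X,\dim,\kappa)$ with $X$ a finite set (of cells), $\dim\colon X\to\mathbb{Z}$, and an incidence map $\kappa\colon X\times X\to\mathbb{F}$ such that $\sum_{y\in X}\kappa(z,y)\kappa(y,x)=0$ for all $z,x\in X$, and $\kappa(y,x)\neq 0$ only if $\dim y=\dim x+1$. If $\kappa(y,x)\ne 0$, then $x$ is a facet of $y$ and $y$ is a cofacet of $x$. A filter on $X$ is an injective map $f\colon X\to\mathbb{R}$ with $f(x)<f(y)$ whenever $x$ is a facet of $y$. Birth-death pairs: order $X$ by $f$ and let $\Delta$ be the matrix with rows and columns indexed by $X$ in this order, $\Delta[x,y]=\kappa(y,x)$. A reduced form of $\Delta$ is a matrix $R=\Delta\cdot V$ with $V-\mathrm{Id}$ strictly upper triangular and such that the pivots (lowest non-zero entries) of the non-zero columns of $R$ lie in pairwise different rows. $\mathrm{BD}(f)$ is the set of pairs $(s,t)\in X\times X$ such that column $t$ of $R$ is non-zero and its pivot is in row $s$; this does not depend on the choice of $R$. Shallow pairs: $\mathrm{SH}(f)$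 is the set of pairs $(s,t)$ such that $s$ is a facet of $t$, $f(x)\le f(s)$ for all facets $x$ of $t$, and $f(y)\ge f(t)$ for all cofacets $y$ of $s$. One has $\mathrm{SH}(f)\subseteq\mathrm{BD}(f)$. Cancellation: if $s$ is a facet of $t$, the quotient of $X$ by $(s,t)$ is the Lefschetz complex with cells $X\setminus\{s,t\}$, restricted dimension map, and incidence map $\kappa'(y,x)=\kappa(y,x)-\kappa(t,s)^{-1}\kappa(y,s)\kappa(t,x)$. If $(s,t)\in\mathrm{SH}(f)$, the restriction of $f$ is a filter on the quotient. Shallow orders: let $n=\#\mathrm{BD}(f)$. A shallow (cancellation) order of $f$ is an enumeration $\Phi=(\varphi_1,\dots,\varphi_n)$ of $\mathrm{BD}(f)$ such that, setting $X_0=X$, $f_0=f$, and letting $X_i$ be the quotient of $X_{i-1}$ by $\varphi_i$ and $f_i=f|_{X_i}$, one has $\varphi_i\in\mathrm{SH}(f_{i-1})$ for $i=1,\dots,n$. It is identified with the linear order $\varphi_i\le_\Phi\varphi_j\iff i\le j$. Depth poset: $\mathcal{D}_f$ is the partial order on $\mathrm{BD}(f)$ that is the intersection of all shallow orders of $f$: $\chi\le_f\xi$ iff $\chi\le_\Phi\xi$ for every shallow order $\Phi$ of $f$; and $\chi<_f\xi$ means $\chi\le_f\xi$ and $\chi\ne\xi$. A set $S\subseteq\mathrm{BD}(f)$ is shallow cancelable if $S=\{\varphi_1,\dots,\varphi_k\}$ for some shallow order $(\varphi_1,\dots,\varphi_n)$ of $f$ and some $k$. In this case $X^S$ denotes the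 Lefschetz complex $X_k$ obtained by canceling $\varphi_1,\dots,\varphi_k$ in this order (it depends only on $S$, not on the chosen shallow order), and $f^S=f|_{X^S}$, which is a filter on $X^S$. *)

theory Defs
  imports Complex_Main
begin

text \<open>
  The incidence map (and a filter, below) is a total function, but only its values on cells matter:
  every definition quantifies over cells only. In particular a filter and its restriction to a
  smaller set of cells are represented by the same function.
\<close>

record ('a, 'k) lefschetz =
  cells :: "'a set"
  cell_dim :: "'a \<Rightarrow> int"
  incidence :: "'a \<Rightarrow> 'a \<Rightarrow> 'k"

definition lefschetz_complex :: "('a, 'k::field) lefschetz \<Rightarrow> bool" where
  "lefschetz_complex K \<longleftrightarrow>
     finite (cells K) \<and>
     (\<forall>z\<in>cells K. \<forall>x\<in>cells K. (\<Sum>y\<in>cells K. incidence K z y * incidence K y x) = 0) \<and>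
     (\<forall>y\<in>cells K. \<forall>x\<in>cells K. incidence K y x \<noteq> 0 \<longrightarrow> cell_dim K y = cell_dim K x + 1)"

definition facet :: "('a, 'k::field) lefschetz \<Rightarrow> 'a \<Rightarrow> 'a \<Rightarrow> bool" where
  "facet K x y \<longleftrightarrow> x \<in> cells K \<and> y \<in> cells K \<and> incidence K y x \<noteq> 0"

abbreviation cofacet :: "('a, 'k::field) lefschetz \<Rightarrow> 'a \<Rightarrow> 'a \<Rightarrow> bool" where
  "cofacet K y x \<equiv> facet K x y"

definition lefschetz_filter :: "('a, 'k::field) lefschetz \<Rightarrow> ('a \<Rightarrow> real) \<Rightarrow> bool" where
  "lefschetz_filter K f \<longleftrightarrow>
     inj_on f (cells K) \<and> (\<forall>x y. facet K x y \<longrightarrow> f x < f y)"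

text \<open>
  Matrices are indexed by the cells themselves, row first; the order of rows and columns is the
  one induced by \<open>f\<close>.
\<close>

definition boundary_matrix :: "('a, 'k::field) lefschetz \<Rightarrow> 'a \<Rightarrow> 'a \<Rightarrow> 'k" where
  "boundary_matrix K x y = incidence K y x"

definition is_pivot ::
  "('a, 'k::field) lefschetz \<Rightarrow> ('a \<Rightarrow> real) \<Rightarrow> ('a \<Rightarrow> 'a \<Rightarrow> 'k) \<Rightarrow> 'a \<Rightarrow> 'a \<Rightarrow> bool" where
  "is_pivot K f R s t \<longleftrightarrow>
     s \<in> cells K \<and> t \<in> cells K \<and> R s t \<noteq> 0 \<and> (\<forall>x\<in>cells K. f s < f x \<longrightarrow> R x t = 0)"

definition reduced_form ::
  "('a, 'k::field) lefschetz \<Rightarrow> ('a \<Rightarrow> real) \<Rightarrow> ('a \<Rightarrow> 'a \<Rightarrow> 'k) \<Rightarrow> bool" where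
  "reduced_form K f R \<longleftrightarrow>
     (\<exists>V. (\<forall>x\<in>cells K. \<forall>y\<in>cells K. f y \<le> f x \<longrightarrow> V x y = (if x = y then 1 else 0)) \<and>
          (\<forall>x\<in>cells K. \<forall>y\<in>cells K.
             R x y = (\<Sum>z\<in>cells K. boundary_matrix K x z * V z y))) \<and>
     (\<forall>s t t'. is_pivot K f R s t \<and> is_pivot K f R s t' \<longrightarrow> t = t')"

text \<open>
  The reduced form is not unique, but all reduced forms have the same pivots, so the existential
  quantifier below amounts to fixing any one of them.
\<close>

definition BD :: "('a, 'k::field) lefschetz \<Rightarrow> ('a \<Rightarrow> real) \<Rightarrow> ('a \<times> 'a) set" where
  "BD K f = {(s, t). \<exists>R. reduced_form K f R \<and> is_pivot K f R s t}"

definition SH :: "('a, 'k::field) lefschetz \<Rightarrow> ('a \<Rightarrow> real) \<Rightarrow> ('a \<times> 'a) set" where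
  "SH K f = {(s, t). facet K s t \<and>
     (\<forall>x. facet K x t \<longrightarrow> f x \<le> f s) \<and> (\<forall>y. cofacet K y s \<longrightarrow> f y \<ge> f t)}"

definition cancel :: "'a \<times> 'a \<Rightarrow> ('a, 'k::field) lefschetz \<Rightarrow> ('a, 'k) lefschetz" where
  "cancel = (\<lambda>(s, t) K. \<lparr>
     cells = cells K - {s, t},
     cell_dim = cell_dim K,
     incidence = (\<lambda>y x. incidence K y x
       - inverse (incidence K t s) * incidence K y s * incidence K t x)\<rparr>)"

definition cancel_list ::
  "('a \<times> 'a) list \<Rightarrow> ('a, 'k::field) lefschetz \<Rightarrow> ('a, 'k) lefschetz" where
  "cancel_list \<phi>s K = fold cancel \<phi>s K"

text \<open>Lists are indexed from 0, so \<open>\<Phi> ! i\<close> is cancelled after the first \<open>i\<close> entries of \<open>\<Phi>\<close>.\<close>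

definition shallow_order ::
  "('a, 'k::field) lefschetz \<Rightarrow> ('a \<Rightarrow> real) \<Rightarrow> ('a \<times> 'a) list \<Rightarrow> bool" where
  "shallow_order K f \<Phi> \<longleftrightarrow>
     distinct \<Phi> \<and> set \<Phi> = BD K f \<and>
     (\<forall>i<length \<Phi>. \<Phi> ! i \<in> SH (cancel_list (take i \<Phi>) K) f)"

definition list_le :: "'b list \<Rightarrow> 'b \<Rightarrow> 'b \<Rightarrow> bool" where
  "list_le \<Phi> a b \<longleftrightarrow> (\<exists>i j. i \<le> j \<and> j < length \<Phi> \<and> \<Phi> ! i = a \<and> \<Phi> ! j = b)"

definition depth_le ::
  "('a, 'k::field) lefschetz \<Rightarrow> ('a \<Rightarrow> real) \<Rightarrow> 'a \<times> 'a \<Rightarrow> 'a \<times> 'a \<Rightarrow> bool" where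
  "depth_le K f \<chi> \<xi> \<longleftrightarrow>
     \<chi> \<in> BD K f \<and> \<xi> \<in> BD K f \<and> (\<forall>\<Phi>. shallow_order K f \<Phi> \<longrightarrow> list_le \<Phi> \<chi> \<xi>)"

definition depth_less ::
  "('a, 'k::field) lefschetz \<Rightarrow> ('a \<Rightarrow> real) \<Rightarrow> 'a \<times> 'a \<Rightarrow> 'a \<times> 'a \<Rightarrow> bool" where
  "depth_less K f \<chi> \<xi> \<longleftrightarrow> depth_le K f \<chi> \<xi> \<and> \<chi> \<noteq> \<xi>"

definition shallow_cancelable ::
  "('a, 'k::field) lefschetz \<Rightarrow> ('a \<Rightarrow> real) \<Rightarrow> ('a \<times> 'a) set \<Rightarrow> bool" where
  "shallow_cancelable K f S \<longleftrightarrow>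
     (\<exists>\<Phi> k. shallow_order K f \<Phi> \<and> k \<le> length \<Phi> \<and> S = set (take k \<Phi>))"

text \<open>
  \<open>cancels_to K f S KS\<close> says that \<open>KS\<close> is the complex $X^S$ obtained by cancelling \<open>S\<close> along
  some shallow order that starts with \<open>S\<close>. It is a relation rather than a function of \<open>S\<close>, so
  that a statement about all such \<open>KS\<close> does not rest on the independence of the chosen order.
\<close>

definition cancels_to ::
  "('a, 'k::field) lefschetz \<Rightarrow> ('a \<Rightarrow> real) \<Rightarrow> ('a \<times> 'a) set \<Rightarrow> ('a, 'k) lefschetz \<Rightarrow> bool" where
  "cancels_to K f S KS \<longleftrightarrow>
     (\<exists>\<Phi> k. shallow_order K f \<Phi> \<and> k \<le> length \<Phi> \<and> S = set (take k \<Phi>) \<and>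
            KS = cancel_list (take k \<Phi>) K)"

end

theory Submission
  imports Defs
begin

text \<open>
  Cancelling shallow pairs is a confluent rewriting process, and the theorem is a statement about
  such a process in which, in addition, every step has a \<^emph>\<open>least\<close> set of steps that enable it.
  Three local facts about a complex carry everything.
  First, a shallow pair remains shallow when another shallow pair is cancelled
  (\<open>SH_cancel\<close>). Second, two shallow cancellations commute, with equality of the resulting
  complexes (\<open>cancel_commute\<close>). Third, a pair that becomes shallow by cancelling \<open>\<phi>\<close>
  and also by cancelling a different \<open>\<psi>\<close> was shallow from the start
  (\<open>SH_if_SH_cancel_both\<close>): otherwise the largest facet of its upper cell or the smallest
  cofacet of its lower cell would obstruct it, and such an obstruction disappears only when the
  pair that contains it is cancelled, which cannot be both \<open>\<phi>\<close> and \<open>\<psi>\<close>.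

  The first two facts imply that a sequence of shallow cancellations can be prefixed by any other
  one, after skipping the pairs that are already gone (\<open>shallow_seq_residual\<close>). Together
  with the third fact, an induction shows that two sequences enabling a pair can be replaced
  by one that uses only their common members (\<open>shallow_seq_meet\<close>).

  If \<open>\<chi>\<close> is shallow after \<open>S\<close>, then some shallow order starts with \<open>S\<close> and continues
  with \<open>\<chi>\<close>, so nothing outside \<open>S\<close> precedes \<open>\<chi>\<close> in the depth poset. Conversely, take a
  smallest sequence of further cancellations that makes \<open>\<chi>\<close> shallow after \<open>S\<close>. A member \<open>\<xi>\<close>
  of it that is not below \<open>\<chi>\<close> is avoided by some shallow order before it reaches \<open>\<chi>\<close>; meeting the
  two sequences would produce a smaller one. So all members are below \<open>\<chi>\<close>, and if \<open>S\<close>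
  contains everything below \<open>\<chi>\<close>, then the sequence is empty.
\<close>

section \<open>Cancelling one shallow pair\<close>

abbreviation filtered_complex :: "('a, 'k::field) lefschetz \<Rightarrow> ('a \<Rightarrow> real) \<Rightarrow> bool" where
  "filtered_complex K f \<equiv> lefschetz_complex K \<and> lefschetz_filter K f"

lemma SH_iff:
  "(s, t) \<in> SH K f \<longleftrightarrow>
     facet K s t \<and> (\<forall>x. facet K x t \<longrightarrow> f x \<le> f s) \<and> (\<forall>y. facet K s y \<longrightarrow> f t \<le> f y)"
  by (simp add: SH_def)

lemma cells_cancel [simp]: "cells (cancel (s, t) K) = cells K - {s, t}"
  by (simp add: cancel_def)

lemma incidence_cancel:
  "incidence (cancel (s, t) K) y x =
     incidence K y x - inverse (incidence K t s) * incidence K y s * incidence K t x"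
  by (simp add: cancel_def)

lemma facet_cancelD:
  assumes "facet (cancel (s, t) K) x y" and "facet K s t"
  shows "facet K x y \<or> (facet K x t \<and> facet K s y)"
  using assms by (auto simp: facet_def incidence_cancel)

lemma facet_imp_facet_cancel:
  assumes "facet K x y" and "facet K s t" and "x \<notin> {s, t}" and "y \<notin> {s, t}"
    and "\<not> (facet K x t \<and> facet K s y)"
  shows "facet (cancel (s, t) K) x y"
  using assms by (auto simp: facet_def incidence_cancel)

lemma filter_eqD:
  assumes "filtered_complex K f" and "x \<in> cells K" and "y \<in> cells K" and "f x = f y"
  shows "x = y"
  using assms by (auto simp: lefschetz_filter_def inj_on_def)

lemma facet_cells: "facet K x y \<Longrightarrow> x \<in> cells K \<and> y \<in> cells K"
  by (simp add: facet_def)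

lemma SH_cells: "(s, t) \<in> SH K f \<Longrightarrow> s \<in> cells K \<and> t \<in> cells K"
  by (simp add: SH_def facet_def)

lemma facet_less: "filtered_complex K f \<Longrightarrow> facet K x y \<Longrightarrow> f x < f y"
  by (auto simp: lefschetz_filter_def)

text \<open>
  In the equation expressing that the square of the boundary vanishes, a non-zero summand cannot
  stand alone.
\<close>

lemma second_path:
  assumes "lefschetz_complex K" and "facet K x y" and "facet K y z"
  obtains y' where "y' \<noteq> y" "facet K x y'" "facet K y' z"
proof -
  have fin: "finite (cells K)" and y: "y \<in> cells K"
    using assms by (auto simp: lefschetz_complex_def facet_def)
  have "(\<Sum>v\<in>cells K. incidence K z v * incidence K v x) = 0"
    using assms by (auto simp: lefschetz_complex_def facet_def)
  then have "incidence K z y * incidence K y x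
      + (\<Sum>v\<in>cells K - {y}. incidence K z v * incidence K v x) = 0"
    by (simp add: sum.remove [OF fin y])
  moreover have "incidence K z y * incidence K y x \<noteq> 0"
    using assms by (simp add: facet_def)
  ultimately have "(\<Sum>v\<in>cells K - {y}. incidence K z v * incidence K v x) \<noteq> 0"
    by auto
  then obtain v where "v \<in> cells K - {y}" "incidence K z v * incidence K v x \<noteq> 0"
    by (rule sum.not_neutral_contains_not_neutral)
  then show thesis
    using assms by (intro that [of v]) (auto simp: facet_def)
qed

text \<open>
  The new incidence map vanishes on column \<open>s\<close> and row \<open>t\<close>, so the sum over the remaining
  cells equals the sum over all old cells, which is a combination of four old sums.
\<close>

lemma lefschetz_complex_cancel:
  assumes K: "lefschetz_complex K" and st: "facet K s t"
  shows "lefschetz_complex (cancel (s, t) K)"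
proof -
  let ?c = "inverse (incidence K t s)"
  let ?d = "incidence K"
  let ?d' = "incidence (cancel (s, t) K)"
  have fin: "finite (cells K)"
    and sq: "\<And>z x. z \<in> cells K \<Longrightarrow> x \<in> cells K \<Longrightarrow> (\<Sum>y\<in>cells K. ?d z y * ?d y x) = 0"
    and dim: "\<And>y x. y \<in> cells K \<Longrightarrow> x \<in> cells K \<Longrightarrow> ?d y x \<noteq> 0 \<Longrightarrow>
      cell_dim K y = cell_dim K x + 1"
    using K by (auto simp: lefschetz_complex_def)
  have s: "s \<in> cells K" and t: "t \<in> cells K" and ts: "?d t s \<noteq> 0"
    using st by (auto simp: facet_def)
  have "(\<Sum>y\<in>cells K - {s, t}. ?d' z y * ?d' y x) = 0" if z: "z \<in> cells K" and x: "x \<in> cells K"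
    for z x
  proof -
    have "?d' z s = 0" and "?d' t x = 0"
      using ts by (auto simp: incidence_cancel)
    then have "(\<Sum>y\<in>cells K - {s, t}. ?d' z y * ?d' y x) = (\<Sum>y\<in>cells K. ?d' z y * ?d' y x)"
      using fin by (intro sum.mono_neutral_left) auto
    also have "\<dots> = (\<Sum>y\<in>cells K. ?d z y * ?d y x - (?c * ?d t x) * (?d z y * ?d y s)
        - (?c * ?d z s) * (?d t y * ?d y x) + (?c * ?c * ?d z s * ?d t x) * (?d t y * ?d y s))"
      by (rule sum.cong) (simp_all add: incidence_cancel algebra_simps)
    also have "\<dots> = 0"
      using s t x z
      by (simp only: sum.distrib sum_subtractf sum_distrib_left [symmetric] sq) simp
    finally show ?thesis .
  qed
  moreover have "cell_dim K y = cell_dim K x + 1"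
    if "y \<in> cells K" "x \<in> cells K" "?d' y x \<noteq> 0" for y x
  proof (cases "?d y x = 0")
    case True
    then have "?d y s \<noteq> 0" "?d t x \<noteq> 0"
      using that by (auto simp: incidence_cancel)
    then show ?thesis
      using dim [of y s] dim [of t x] dim [of t s] that s t ts by simp
  qed (use that dim in blast)
  ultimately show ?thesis
    using fin by (auto simp: lefschetz_complex_def cancel_def)
qed

lemma lefschetz_filter_cancel:
  assumes K: "filtered_complex K f" and st: "(s, t) \<in> SH K f"
  shows "lefschetz_filter (cancel (s, t) K) f"
  unfolding lefschetz_filter_def
proof (intro conjI allI impI)
  show "inj_on f (cells (cancel (s, t) K))"
    using K by (auto simp: lefschetz_filter_def intro: inj_on_subset)
next
  fix x y
  assume "facet (cancel (s, t) K) x y"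
  then have "facet K x y \<or> (facet K x t \<and> facet K s y)"
    using st by (intro facet_cancelD) (auto simp: SH_iff)
  moreover have "f x < f y" if "facet K x t" "facet K s y"
  proof -
    have "f x \<le> f s" "f s < f t" "f t \<le> f y"
      using that st K by (auto simp: SH_iff facet_less)
    then show ?thesis by simp
  qed
  ultimately show "f x < f y"
    using facet_less [OF K, of x y] by blast
qed

lemma filtered_complex_cancel:
  assumes "filtered_complex K f" and "\<phi> \<in> SH K f"
  shows "filtered_complex (cancel \<phi> K) f"
proof (cases \<phi>)
  case (Pair s t)
  then have "facet K s t"
    using assms(2) by (simp add: SH_iff)
  then show ?thesis
    using assms Pair lefschetz_complex_cancel [of K s t] lefschetz_filter_cancel [of K f s t]
    by blast
qed

section \<open>Interaction of shallow pairs\<close>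

text \<open>
  If the upper cell \<open>t\<close> of one shallow pair were the lower cell of another one \<open>(t, b)\<close>, a second
  path from \<open>b\<close> down to \<open>s\<close> would pass through a cell that is both below and above \<open>t\<close>.
\<close>

lemma SH_death_not_birth:
  assumes K: "filtered_complex K f" and st: "(s, t) \<in> SH K f"
  shows "(t, b) \<notin> SH K f"
proof
  assume tb: "(t, b) \<in> SH K f"
  obtain y where y: "y \<noteq> t" "facet K s y" "facet K y b"
    using K st tb second_path [of K s t b] by (auto simp: SH_iff)
  then have "f t = f y"
    using st tb by (intro order.antisym) (auto simp: SH_iff)
  then show False
    using filter_eqD [OF K, of t y] facet_cells [OF y(2)] SH_cells [OF st] y(1) by auto
qed

lemma SH_same_birth:
  assumes "filtered_complex K f" and "(s, t) \<in> SH K f" and "(s, b) \<in> SH K f"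
  shows "t = b"
  using assms SH_cells [OF assms(2)] SH_cells [OF assms(3)]
  by (intro filter_eqD [OF assms(1)] order.antisym) (auto simp: SH_iff)

lemma SH_same_death:
  assumes "filtered_complex K f" and "(s, t) \<in> SH K f" and "(a, t) \<in> SH K f"
  shows "s = a"
  using assms SH_cells [OF assms(2)] SH_cells [OF assms(3)]
  by (intro filter_eqD [OF assms(1)] order.antisym) (auto simp: SH_iff)

lemma SH_disjoint:
  assumes "filtered_complex K f" and "(s, t) \<in> SH K f" and "(a, b) \<in> SH K f"
    and "(s, t) \<noteq> (a, b)"
  shows "s \<noteq> a" "t \<noteq> b" "s \<noteq> b" "t \<noteq> a"
  using SH_same_birth [OF assms(1-2), of b] SH_same_death [OF assms(1-2), of a]
    SH_death_not_birth [OF assms(1-2), of b] SH_death_not_birth [OF assms(1,3), of t] assms(2-4)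
  by auto

text \<open>
  The incidences between two shallow pairs form a triangular matrix with non-zero diagonal. This
  is what makes the two cancellations independent of each other.
\<close>

lemma SH_triangular:
  assumes K: "filtered_complex K f" and st: "(s, t) \<in> SH K f" and ab: "(a, b) \<in> SH K f"
    and ne: "(s, t) \<noteq> (a, b)"
  shows "\<not> facet K s b \<or> \<not> facet K a t"
proof (rule ccontr)
  assume "\<not> ?thesis"
  then have "f s = f a"
    using st ab by (intro order.antisym) (auto simp: SH_iff)
  then show False
    using SH_disjoint(1) [OF K st ab ne] filter_eqD [OF K, of s a] SH_cells [OF st] SH_cells [OF ab]
    by auto
qed

lemma SH_cancel:
  assumes K: "filtered_complex K f" and \<phi>: "\<phi> \<in> SH K f" and \<psi>: "\<psi> \<in> SH K f" and ne: "\<phi> \<noteq> \<psi>"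
  shows "\<psi> \<in> SH (cancel \<phi> K) f"
proof -
  obtain s t a b where eq: "\<phi> = (s, t)" "\<psi> = (a, b)"
    by (cases \<phi>, cases \<psi>)
  have st: "(s, t) \<in> SH K f" and ab: "(a, b) \<in> SH K f" and ne': "(s, t) \<noteq> (a, b)"
    using \<phi> \<psi> ne eq by auto
  note dis = SH_disjoint [OF K st ab ne']
  have "facet (cancel (s, t) K) a b"
    using facet_imp_facet_cancel [of K a b s t] SH_triangular [OF K st ab ne'] st ab dis
    by (auto simp: SH_iff)
  moreover have "f x \<le> f a" if "facet (cancel (s, t) K) x b" for x
    using facet_cancelD [OF that] st ab unfolding SH_iff by (meson order.trans)
  moreover have "f b \<le> f y" if "facet (cancel (s, t) K) a y" for y
    using facet_cancelD [OF that] st ab unfolding SH_iff by (meson order.trans)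
  ultimately show ?thesis
    by (auto simp: eq SH_iff)
qed

lemma cancel_commute:
  assumes K: "filtered_complex K f" and \<phi>: "\<phi> \<in> SH K f" and \<psi>: "\<psi> \<in> SH K f" and ne: "\<phi> \<noteq> \<psi>"
  shows "cancel \<phi> (cancel \<psi> K) = cancel \<psi> (cancel \<phi> K)"
proof -
  obtain s t a b where eq: "\<phi> = (s, t)" "\<psi> = (a, b)"
    by (cases \<phi>, cases \<psi>)
  have st: "(s, t) \<in> SH K f" and ab: "(a, b) \<in> SH K f" and ne': "(s, t) \<noteq> (a, b)"
    using \<phi> \<psi> ne eq by auto
  have nz: "incidence K t s \<noteq> 0" "incidence K b a \<noteq> 0"
    and tri: "incidence K b s = 0 \<or> incidence K t a = 0"
    using st ab SH_triangular [OF K st ab ne'] by (auto simp: SH_iff facet_def)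
  from tri have "incidence (cancel (s, t) (cancel (a, b) K)) y x =
      incidence (cancel (a, b) (cancel (s, t) K)) y x" for y x
    using nz by (elim disjE) (simp_all add: incidence_cancel field_simps)
  moreover have "cells K - {s, t} - {a, b} = cells K - {a, b} - {s, t}"
    by blast
  ultimately show ?thesis
    unfolding eq by (intro lefschetz.equality ext) (simp_all add: cancel_def)
qed

text \<open>
  Cancelling \<open>(s, t)\<close> removes the facet \<open>x\<close> of \<open>b\<close> only if \<open>x\<close> lies in \<open>{s, t}\<close>, or if \<open>x\<close> is a facet
  of \<open>t\<close> and \<open>s\<close> a facet of \<open>b\<close>. In the last case \<open>x\<close> is not above \<open>s\<close>, and being
  the largest facet of \<open>b\<close> it is not below \<open>s\<close> either. The cell \<open>t\<close> is never the largest facet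
  of \<open>b\<close>, because a second path from \<open>b\<close> to \<open>s\<close> uses a larger one.
\<close>

lemma largest_facet_removed:
  assumes K: "filtered_complex K f" and st: "(s, t) \<in> SH K f"
    and ab: "(a, b) \<in> SH (cancel (s, t) K) f"
    and x: "facet K x b" and largest: "\<And>x'. facet K x' b \<Longrightarrow> f x' \<le> f x" and ax: "f a < f x"
  shows "x = s"
proof (rule ccontr)
  assume "x \<noteq> s"
  have "x \<noteq> t"
  proof
    assume "x = t"
    then obtain y where y: "y \<noteq> t" "facet K s y" "facet K y b"
      using K st x second_path [of K s t b] by (auto simp: SH_iff)
    then have "f t = f y"
      using st largest \<open>x = t\<close> by (intro order.antisym) (auto simp: SH_iff)
    then show False
      using filter_eqD [OF K, of t y] facet_cells [OF y(2)] SH_cells [OF st] y(1) by auto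
  qed
  moreover have "b \<notin> {s, t}"
    using SH_cells [OF ab] by auto
  moreover have "\<not> facet (cancel (s, t) K) x b"
    using ab ax by (force simp: SH_iff)
  ultimately have "facet K x t" "facet K s b"
    using facet_imp_facet_cancel [of K x b s t] x st \<open>x \<noteq> s\<close> by (auto simp: SH_iff)
  then have "f x = f s"
    using st largest by (intro order.antisym) (auto simp: SH_iff)
  then show False
    using filter_eqD [OF K, of x s] facet_cells [OF x] SH_cells [OF st] \<open>x \<noteq> s\<close> by auto
qed

text \<open>The previous argument with all incidences reversed.\<close>

lemma smallest_cofacet_removed:
  assumes K: "filtered_complex K f" and st: "(s, t) \<in> SH K f"
    and ab: "(a, b) \<in> SH (cancel (s, t) K) f"
    and y: "facet K a y" and smallest: "\<And>y'. facet K a y' \<Longrightarrow> f y \<le> f y'" and yb: "f y < f b"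
  shows "y = t"
proof (rule ccontr)
  assume "y \<noteq> t"
  have "y \<noteq> s"
  proof
    assume "y = s"
    then obtain x where x: "x \<noteq> s" "facet K a x" "facet K x t"
      using K st y second_path [of K a s t] by (auto simp: SH_iff)
    then have "f s = f x"
      using st smallest \<open>y = s\<close> by (intro order.antisym) (auto simp: SH_iff)
    then show False
      using filter_eqD [OF K, of s x] facet_cells [OF x(2)] SH_cells [OF st] x(1) by auto
  qed
  moreover have "a \<notin> {s, t}"
    using SH_cells [OF ab] by auto
  moreover have "\<not> facet (cancel (s, t) K) a y"
    using ab yb by (force simp: SH_iff)
  ultimately have "facet K a t" "facet K s y"
    using facet_imp_facet_cancel [of K a y s t] y st \<open>y \<noteq> t\<close> by (auto simp: SH_iff)
  then have "f y = f t"
    using st smallest by (intro order.antisym) (auto simp: SH_iff)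
  then show False
    using filter_eqD [OF K, of y t] facet_cells [OF y] SH_cells [OF st] \<open>y \<noteq> t\<close> by auto
qed

text \<open>
  The largest facet of \<open>b\<close>, if it lies above \<open>a\<close>, would have to be the lower cell of both
  cancelled pairs, and these are disjoint; likewise for the smallest cofacet of \<open>a\<close>.
\<close>

lemma SH_if_SH_cancel_both:
  assumes K: "filtered_complex K f" and \<phi>: "\<phi> \<in> SH K f" and \<psi>: "\<psi> \<in> SH K f" and ne: "\<phi> \<noteq> \<psi>"
    and \<chi>\<phi>: "\<chi> \<in> SH (cancel \<phi> K) f" and \<chi>\<psi>: "\<chi> \<in> SH (cancel \<psi> K) f"
  shows "\<chi> \<in> SH K f"
proof -
  obtain s t s' t' a b where eq: "\<phi> = (s, t)" "\<psi> = (s', t')" "\<chi> = (a, b)"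
    by (cases \<phi>, cases \<psi>, cases \<chi>)
  note SHs = \<phi> [unfolded eq] \<psi> [unfolded eq]
  note ab = \<chi>\<phi> [unfolded eq] \<chi>\<psi> [unfolded eq]
  note dis = SH_disjoint [OF K SHs ne [unfolded eq]]
  have fin: "finite {x. facet K x b}" "finite {y. facet K a y}"
    using K by (auto simp: lefschetz_complex_def facet_def)
  have facets: "f x \<le> f a" if x: "facet K x b" for x
  proof (rule ccontr)
    assume "\<not> f x \<le> f a"
    obtain z where z: "facet K z b" and max: "Max (f ` {x. facet K x b}) = f z"
      using obtains_MAX [OF fin(1), of f] x by blast
    have largest: "f x' \<le> f z" if "facet K x' b" for x'
      using Max_ge [of "f ` {x. facet K x b}" "f x'"] fin(1) that max by auto
    have "f a < f z"
      using largest [OF x] \<open>\<not> f x \<le> f a\<close> by simp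
    then have "z = s" "z = s'"
      using largest_facet_removed [OF K SHs(1) ab(1) z largest]
        largest_facet_removed [OF K SHs(2) ab(2) z largest] by blast+
    then show False
      using dis by blast
  qed
  have cofacets: "f b \<le> f y" if y: "facet K a y" for y
  proof (rule ccontr)
    assume "\<not> f b \<le> f y"
    obtain z where z: "facet K a z" and min: "Min (f ` {y. facet K a y}) = f z"
      using obtains_MIN [OF fin(2), of f] y by blast
    have smallest: "f z \<le> f y'" if "facet K a y'" for y'
      using Min_le [of "f ` {y. facet K a y}" "f y'"] fin(2) that min by auto
    have "f z < f b"
      using smallest [OF y] \<open>\<not> f b \<le> f y\<close> by simp
    then have "z = t" "z = t'"
      using smallest_cofacet_removed [OF K SHs(1) ab(1) z smallest]
        smallest_cofacet_removed [OF K SHs(2) ab(2) z smallest] by blast+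
    then show False
      using dis by blast
  qed
  (* If a were a facet of b only after cancelling (s, t), then s would be a facet of b and a a
     facet of t, so that neither of a and s could lie above the other. *)
  have "facet K a b"
  proof (rule ccontr)
    assume "\<not> facet K a b"
    then have "facet K a t" "facet K s b"
      using facet_cancelD [of s t K a b] ab(1) SHs(1) by (auto simp: SH_iff)
    then have "f a = f s"
      using facets SHs(1) by (intro order.antisym) (auto simp: SH_iff)
    then have "a = s"
      using filter_eqD [OF K, of a s] facet_cells [OF \<open>facet K a t\<close>] SH_cells [OF SHs(1)] by auto
    then show False
      using SH_cells [OF ab(1)] by auto
  qed
  with facets cofacets show ?thesis
    by (simp add: eq SH_iff)
qed

section \<open>Sequences of shallow cancellations\<close>

fun shallow_seq ::
  "('a, 'k::field) lefschetz \<Rightarrow> ('a \<Rightarrow> real) \<Rightarrow> ('a \<times> 'a) list \<Rightarrow> bool" where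
  "shallow_seq K f [] \<longleftrightarrow> True"
| "shallow_seq K f (\<phi> # \<phi>s) \<longleftrightarrow> \<phi> \<in> SH K f \<and> shallow_seq (cancel \<phi> K) f \<phi>s"

lemma cancel_list_simps [simp]:
  "cancel_list [] K = K"
  "cancel_list (\<phi> # \<phi>s) K = cancel_list \<phi>s (cancel \<phi> K)"
  by (simp_all add: cancel_list_def)

lemma shallow_seq_append:
  "shallow_seq K f (\<phi>s @ \<psi>s) \<longleftrightarrow> shallow_seq K f \<phi>s \<and> shallow_seq (cancel_list \<phi>s K) f \<psi>s"
  by (induction \<phi>s arbitrary: K) auto

lemma shallow_seq_iff_nth:
  "shallow_seq K f \<phi>s \<longleftrightarrow> (\<forall>i<length \<phi>s. \<phi>s ! i \<in> SH (cancel_list (take i \<phi>s) K) f)"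
  by (induction \<phi>s arbitrary: K) (auto simp: All_less_Suc2)

lemma shallow_seq_fst_in_cells:
  "shallow_seq K f \<phi>s \<Longrightarrow> \<phi> \<in> set \<phi>s \<Longrightarrow> fst \<phi> \<in> cells K"
proof (induction \<phi>s arbitrary: K)
  case (Cons \<psi> \<phi>s)
  then show ?case
    by (cases \<psi>; cases \<phi>) (fastforce simp: SH_iff facet_def)
qed simp

lemma shallow_seq_distinct: "shallow_seq K f \<phi>s \<Longrightarrow> distinct \<phi>s"
proof (induction \<phi>s arbitrary: K)
  case (Cons \<psi> \<phi>s)
  then show ?case
    using shallow_seq_fst_in_cells [of "cancel \<psi> K" f \<phi>s \<psi>] by (cases \<psi>) auto
qed simp

text \<open>
  Moving a cancellation to the front of a sequence: it commutes with every earlier member of the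
  sequence by the two-pair case.
\<close>

lemma shallow_seq_remove1:
  assumes "filtered_complex K f" and "\<phi> \<in> SH K f" and "shallow_seq K f \<psi>s"
  shows "shallow_seq (cancel \<phi> K) f (remove1 \<phi> \<psi>s)"
  using assms
proof (induction \<psi>s arbitrary: K)
  case (Cons \<psi> \<psi>s)
  show ?case
  proof (cases "\<psi> = \<phi>")
    case False
    have \<psi>: "\<psi> \<in> SH K f" and \<psi>s: "shallow_seq (cancel \<psi> K) f \<psi>s"
      using Cons.prems by auto
    have "shallow_seq (cancel \<phi> (cancel \<psi> K)) f (remove1 \<phi> \<psi>s)"
      using Cons.IH [of "cancel \<psi> K"] Cons.prems filtered_complex_cancel [of K f \<psi>]
        SH_cancel [of K f \<psi> \<phi>] \<psi> \<psi>s False by blast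
    then show ?thesis
      using False Cons.prems \<psi> SH_cancel [of K f \<phi> \<psi>] cancel_commute [of K f \<phi> \<psi>] by simp
  qed (use Cons.prems in simp)
qed simp

lemma shallow_seq_residual:
  assumes "filtered_complex K f" and "shallow_seq K f \<phi>s" and "shallow_seq K f \<psi>s"
  shows "shallow_seq (cancel_list \<phi>s K) f (filter (\<lambda>\<psi>. \<psi> \<notin> set \<phi>s) \<psi>s)"
  using assms
proof (induction \<phi>s arbitrary: K \<psi>s)
  case (Cons \<phi> \<phi>s)
  then have \<phi>: "\<phi> \<in> SH K f" and \<phi>s: "shallow_seq (cancel \<phi> K) f \<phi>s"
    by auto
  have "shallow_seq (cancel_list \<phi>s (cancel \<phi> K)) f
      (filter (\<lambda>\<psi>. \<psi> \<notin> set \<phi>s) (remove1 \<phi> \<psi>s))"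
    by (intro Cons.IH filtered_complex_cancel shallow_seq_remove1 Cons.prems \<phi> \<phi>s)
  moreover have "remove1 \<phi> \<psi>s = filter (\<lambda>\<psi>. \<psi> \<noteq> \<phi>) \<psi>s"
    using shallow_seq_distinct [OF Cons.prems(3)]
    by (simp add: distinct_remove1_removeAll removeAll_filter_not_eq eq_commute)
  ultimately show ?case
    by (simp add: conj_commute)
qed simp

lemma filtered_complex_cancel_list:
  assumes "filtered_complex K f" and "shallow_seq K f \<phi>s"
  shows "filtered_complex (cancel_list \<phi>s K) f"
  using assms
proof (induction \<phi>s arbitrary: K)
  case (Cons \<phi> \<phi>s)
  then show ?case
    using filtered_complex_cancel [of K f \<phi>] by simp
qed simp

text \<open>
  The local fact about two pairs, lifted to sequences. If the sequences share a shallow pair, it is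
  moved to the front of both. Otherwise let \<open>p\<close> and \<open>q\<close> be the two first pairs. After cancelling
  \<open>p\<close> there remain the tail of the first sequence and the whole second one, so by
  induction \<open>\<chi>\<close> can be enabled by common members. The first of these, \<open>c\<close>, would be enabled by
  cancelling \<open>p\<close> as well as by the part of the second sequence in front of \<open>c\<close>; as these are
  disjoint and shorter, \<open>c\<close> would be a shared shallow pair, which was excluded. So no common member
  is used, and \<open>\<chi>\<close> is shallow after cancelling \<open>p\<close>. By symmetry it is shallow after cancelling
  \<open>q\<close>, and the fact about two pairs applies.
\<close>

lemma shallow_seq_meet:
  assumes "filtered_complex K f" and "shallow_seq K f (P @ [\<chi>])" and "shallow_seq K f (Q @ [\<chi>])"
  shows "\<exists>C. set C \<subseteq> set P \<inter> set Q \<and> shallow_seq K f (C @ [\<chi>])"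
  using assms
proof (induction "length P + length Q" arbitrary: K P Q \<chi> rule: less_induct)
  case less
  note K = less.prems(1)
  show ?case
  proof (cases "P = [] \<or> Q = []")
    case True
    then show ?thesis
      using less.prems by (intro exI [of _ "[]"]) auto
  next
    case nonempty: False
    have disP: "distinct (P @ [\<chi>])" and disQ: "distinct (Q @ [\<chi>])"
      using less.prems shallow_seq_distinct by blast+
    show ?thesis
    proof (cases "\<exists>c \<in> set P \<inter> set Q. c \<in> SH K f")
      case True
      then obtain c where c: "c \<in> set P" "c \<in> set Q" "c \<in> SH K f"
        by blast
      have "shallow_seq (cancel c K) f (remove1 c P @ [\<chi>])"
        "shallow_seq (cancel c K) f (remove1 c Q @ [\<chi>])"
        using shallow_seq_remove1 [OF K c(3) less.prems(2)]
          shallow_seq_remove1 [OF K c(3) less.prems(3)] c by (simp_all add: remove1_append)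
      moreover have "length (remove1 c P) + length (remove1 c Q) < length P + length Q"
        using c nonempty by (simp add: length_remove1 add_strict_mono)
      ultimately obtain C where "set C \<subseteq> set (remove1 c P) \<inter> set (remove1 c Q)"
        "shallow_seq (cancel c K) f (C @ [\<chi>])"
        using less.hyps [of "remove1 c P" "remove1 c Q" "cancel c K" \<chi>]
          filtered_complex_cancel [OF K c(3)] by blast
      then have "set (c # C) \<subseteq> set P \<inter> set Q \<and> shallow_seq K f ((c # C) @ [\<chi>])"
        using c set_remove1_subset [of c P] set_remove1_subset [of c Q] by auto
      then show ?thesis by blast
    next
      case no_shared: False
      have enabled: "\<chi> \<in> SH (cancel p K) f"
        if A: "A = p # A'" and len: "length A + length B = length P + length Q"
          and sA: "shallow_seq K f (A @ [\<chi>])" and sB: "shallow_seq K f (B @ [\<chi>])"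
          and B: "B \<noteq> []" and no: "\<not> (\<exists>c \<in> set A \<inter> set B. c \<in> SH K f)" for A A' B p
      proof -
        have p: "p \<in> SH K f"
          using A sA by auto
        have "p \<notin> set B" "p \<noteq> \<chi>"
          using A no p shallow_seq_distinct [OF sA] by auto
        then have "shallow_seq (cancel p K) f (B @ [\<chi>])"
          using shallow_seq_remove1 [OF K p sB] by (simp add: remove1_append remove1_idem)
        moreover have "shallow_seq (cancel p K) f (A' @ [\<chi>])"
          using A sA by simp
        ultimately obtain C where C: "set C \<subseteq> set A' \<inter> set B"
          "shallow_seq (cancel p K) f (C @ [\<chi>])"
          using less.hyps [of A' B "cancel p K" \<chi>] filtered_complex_cancel [OF K p] A len by auto
        have "C = []"
        proof (rule ccontr)
          assume "C \<noteq> []"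
          then obtain c C' where "C = c # C'"
            by (cases C) auto
          then have c: "c \<in> set A'" "c \<in> set B" "c \<in> SH (cancel p K) f"
            using C by auto
          obtain B1 B2 where B12: "B = B1 @ c # B2"
            using c split_list by metis
          have "shallow_seq K f ([p] @ [c])" "shallow_seq K f (B1 @ [c])"
            using c p sB B12 by (simp_all add: shallow_seq_append)
          moreover have "length [p] + length B1 < length P + length Q"
            using A len B12 by simp
          ultimately obtain D where "set D \<subseteq> set [p] \<inter> set B1" "shallow_seq K f (D @ [c])"
            using less.hyps [of "[p]" B1 K c] K by blast
          moreover from this(1) have "D = []"
            using \<open>p \<notin> set B\<close> B12 by (cases D) auto
          ultimately have "c \<in> SH K f"
            by simp
          then show False
            using no c A by auto
        qed
        then show ?thesis
          using C by simp
      qed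
      obtain p P' q Q' where PQ: "P = p # P'" "Q = q # Q'"
        using nonempty by (cases P; cases Q) auto
      have "\<chi> \<in> SH (cancel p K) f"
        using enabled [OF PQ(1), of Q] less.prems nonempty no_shared by blast
      moreover have "\<chi> \<in> SH (cancel q K) f"
        using enabled [OF PQ(2), of P] less.prems nonempty no_shared
        by (simp add: Int_commute add.commute)
      moreover have "p \<in> SH K f" "q \<in> SH K f"
        using less.prems PQ by auto
      moreover from this have "p \<noteq> q"
        using no_shared PQ by auto
      ultimately have "\<chi> \<in> SH K f"
        using SH_if_SH_cancel_both [OF K] by blast
      then show ?thesis
        by (intro exI [of _ "[]"]) simp
    qed
  qed
qed

section \<open>Shallow orders and the depth poset\<close>

lemma shallow_order_iff:
  "shallow_order K f \<Phi> \<longleftrightarrow> set \<Phi> = BD K f \<and> shallow_seq K f \<Phi>"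
  using shallow_seq_distinct by (auto simp: shallow_order_def shallow_seq_iff_nth)

text \<open>
  A single shallow order suffices to complete every sequence of shallow cancellations of
  birth-death pairs: append what the sequence has left of it.
\<close>

lemma shallow_order_extend:
  assumes "filtered_complex K f" and "shallow_order K f \<Phi>"
    and "shallow_seq K f \<phi>s" and "set \<phi>s \<subseteq> BD K f"
  obtains \<psi>s where "shallow_order K f (\<phi>s @ \<psi>s)"
proof
  show "shallow_order K f (\<phi>s @ filter (\<lambda>\<psi>. \<psi> \<notin> set \<phi>s) \<Phi>)"
    using assms shallow_seq_residual [of K f \<phi>s \<Phi>]
    by (auto simp: shallow_order_iff shallow_seq_append)
qed

lemma list_le_middleD:
  assumes "distinct (xs @ b # ys)" and "list_le (xs @ b # ys) a b"
  shows "a \<in> set xs \<or> a = b"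
proof -
  obtain i j where ij: "i \<le> j" "j < length (xs @ b # ys)"
    "(xs @ b # ys) ! i = a" "(xs @ b # ys) ! j = b"
    using assms(2) unfolding list_le_def by blast
  have "j = length xs"
    using nth_eq_iff_index_eq [OF assms(1) ij(2), of "length xs"] ij(4) by simp
  then show ?thesis
    using ij by (cases "i = j") (auto simp: nth_append)
qed

lemma list_le_middleI:
  assumes "a \<in> set xs"
  shows "list_le (xs @ b # ys) a b"
proof -
  obtain i where "i < length xs" "xs ! i = a"
    using assms by (auto simp: in_set_conv_nth)
  then show ?thesis
    unfolding list_le_def by (intro exI [of _ i] exI [of _ "length xs"]) (auto simp: nth_append)
qed

text \<open>
  The witness is a shallow order in which \<open>\<chi>\<close> comes immediately after the prefix.
\<close>

lemma depth_less_of_shallow_prefix: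
  assumes K: "filtered_complex K f" and \<Phi>: "shallow_order K f \<Phi>"
    and \<chi>: "\<chi> \<in> BD K f" and sh: "\<chi> \<in> SH (cancel_list (take k \<Phi>) K) f"
    and less: "depth_less K f \<xi> \<chi>"
  shows "\<xi> \<in> set (take k \<Phi>)"
proof -
  let ?S = "take k \<Phi>"
  have "shallow_seq K f (?S @ drop k \<Phi>)"
    using \<Phi> by (simp add: shallow_order_iff)
  then have "shallow_seq K f (?S @ [\<chi>])"
    using sh by (simp add: shallow_seq_append del: append_take_drop_id)
  moreover have "set (?S @ [\<chi>]) \<subseteq> BD K f"
    using \<Phi> \<chi> set_take_subset [of k \<Phi>] by (auto simp: shallow_order_iff)
  ultimately obtain \<psi>s where ord: "shallow_order K f (?S @ \<chi> # \<psi>s)"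
    using shallow_order_extend [OF K \<Phi>, of "?S @ [\<chi>]"] by auto
  then have "list_le (?S @ \<chi> # \<psi>s) \<xi> \<chi>"
    using less by (simp add: depth_less_def depth_le_def)
  then show ?thesis
    using list_le_middleD [of ?S \<chi> \<psi>s \<xi>] ord less
    by (auto simp: shallow_order_def depth_less_def)
qed

text \<open>
  Minimality is by the number of pairs in the enabling sequence, and the sequence is kept inside
  the birth-death pairs because only these are compared by the depth poset. The given shallow order
  provides one such sequence to start from.
\<close>

lemma shallow_if_contains_depth_less:
  assumes K: "filtered_complex K f" and \<Phi>: "shallow_order K f \<Phi>"
    and \<chi>: "\<chi> \<in> BD K f" "\<chi> \<notin> set (take k \<Phi>)"
    and below: "{\<xi> \<in> BD K f. depth_less K f \<xi> \<chi>} \<subseteq> set (take k \<Phi>)"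
  shows "\<chi> \<in> SH (cancel_list (take k \<Phi>) K) f"
proof -
  let ?S = "take k \<Phi>"
  let ?KS = "cancel_list ?S K"
  let ?enables = "\<lambda>C. set C \<subseteq> BD K f \<and> shallow_seq ?KS f (C @ [\<chi>])"
  have "shallow_seq K f (?S @ drop k \<Phi>)"
    using \<Phi> by (simp add: shallow_order_iff)
  then have S: "shallow_seq K f ?S" and rest: "shallow_seq ?KS f (drop k \<Phi>)"
    by (auto simp: shallow_seq_append simp del: append_take_drop_id)
  have KS: "filtered_complex ?KS f"
    by (rule filtered_complex_cancel_list [OF K S])
  have "\<chi> \<in> set (?S @ drop k \<Phi>)"
    using \<chi> \<Phi> by (simp add: shallow_order_iff)
  then have "\<chi> \<in> set (drop k \<Phi>)"
    using \<chi> by (simp del: append_take_drop_id)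
  then obtain C0 C1 where C0: "drop k \<Phi> = C0 @ \<chi> # C1"
    using split_list by metis
  have "?enables C0"
  proof
    have "set C0 \<subseteq> set (drop k \<Phi>)"
      unfolding C0 by auto
    also have "\<dots> \<subseteq> BD K f"
      using set_drop_subset [of k \<Phi>] \<Phi> by (simp add: shallow_order_iff)
    finally show "set C0 \<subseteq> BD K f" .
    show "shallow_seq ?KS f (C0 @ [\<chi>])"
      using rest C0 by (simp add: shallow_seq_append)
  qed
  then obtain C where C: "?enables C" "\<And>D. ?enables D \<Longrightarrow> card (set C) \<le> card (set D)"
    using ex_has_least_nat [of ?enables C0 "\<lambda>C. card (set C)"] by blast
  have "C = []"
  proof (rule ccontr)
    assume "C \<noteq> []"
    then obtain \<xi> where \<xi>: "\<xi> \<in> set C"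
      by (cases C) auto
    have "shallow_seq K f (?S @ C @ [\<chi>])"
      using S C(1) by (simp add: shallow_seq_append)
    then have "distinct (?S @ C @ [\<chi>])"
      by (rule shallow_seq_distinct)
    then have "\<xi> \<notin> set ?S" "\<xi> \<noteq> \<chi>"
      using \<xi> by auto
    moreover have "\<xi> \<in> BD K f"
      using C(1) \<xi> by blast
    ultimately have "\<not> depth_le K f \<xi> \<chi>"
      using below by (auto simp: depth_less_def)
    then obtain \<Psi> where \<Psi>: "shallow_order K f \<Psi>" "\<not> list_le \<Psi> \<xi> \<chi>"
      using \<open>\<xi> \<in> BD K f\<close> \<chi>(1) by (auto simp: depth_le_def)
    then obtain P R where P: "\<Psi> = P @ \<chi> # R"
      using \<chi>(1) split_list [of \<chi> \<Psi>] by (auto simp: shallow_order_iff)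
    then have "\<xi> \<notin> set P"
      using list_le_middleI \<Psi>(2) by metis
    have "shallow_seq K f (P @ [\<chi>])"
      using \<Psi>(1) P by (simp add: shallow_order_iff shallow_seq_append)
    then have "shallow_seq ?KS f (filter (\<lambda>\<psi>. \<psi> \<notin> set ?S) P @ [\<chi>])"
      using shallow_seq_residual [OF K S, of "P @ [\<chi>]"] \<chi>(2) by simp
    then obtain D where D: "set D \<subseteq> set C \<inter> set P" "shallow_seq ?KS f (D @ [\<chi>])"
      using shallow_seq_meet [OF KS, of C \<chi> "filter (\<lambda>\<psi>. \<psi> \<notin> set ?S) P"] C(1) by auto
    then have "card (set C) \<le> card (set D)"
      using C by (intro C(2)) auto
    moreover have "set D \<subset> set C"
      using D(1) \<xi> \<open>\<xi> \<notin> set P\<close> by blast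
    then have "card (set D) < card (set C)"
      by (intro psubset_card_mono) auto
    ultimately show False
      by simp
  qed
  then show ?thesis
    using C(1) by simp
qed

theorem theorem7p13:
  fixes K KS :: "('a, 'k::field) lefschetz"
    and f :: "'a \<Rightarrow> real"
    and S :: "('a \<times> 'a) set"
    and \<chi> :: "'a \<times> 'a"
  assumes "lefschetz_complex K"
    and "lefschetz_filter K f"
    and "S \<subseteq> BD K f"
    and "shallow_cancelable K f S"
    and "cancels_to K f S KS"
    and "\<chi> \<in> BD K f - S"
  shows "\<chi> \<in> SH KS f \<longleftrightarrow> {\<xi> \<in> BD K f. depth_less K f \<xi> \<chi>} \<subseteq> S"
proof -
  obtain \<Phi> k where \<Phi>: "shallow_order K f \<Phi>" and S: "S = set (take k \<Phi>)"
    and KS: "KS = cancel_list (take k \<Phi>) K"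
    using assms(5) unfolding cancels_to_def by blast
  have K: "filtered_complex K f"
    using assms by blast
  show ?thesis
    using depth_less_of_shallow_prefix [OF K \<Phi>, of \<chi> k]
      shallow_if_contains_depth_less [OF K \<Phi>, of \<chi> k] assms(6) unfolding S KS by blast
qed

end
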